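(* For every integer $n\ge 1$ and every real number $x$, $$D_{n}(x)-nD_{n-1}(x)=(x-1)^{n}.$$
   Context: The derangement polynomials $D_n(x)$, $n\ge 0$, are defined by the generating function (formal power series in $t$) $\displaystyle\frac{e^{-t}}{1-t}e^{xt}=\sum_{n=0}^{\infty}D_{n}(x)\frac{t^{n}}{n!}$. *)

theory Defs
  imports "HOL-Computational_Algebra.Computational_Algebra"
begin

text \<open>
  The generating function is a power series in \<open>t\<close> (here \<^const>\<open>fps_X\<close>) whose coefficients
  are polynomials in the indeterminate \<open>x\<close>, i.e. an element of the type \<open>real poly fps\<close>.
  As \<open>real poly\<close> is not a field, \<^const>\<open>fps_exp\<close> and division of power series are not
  available on that type.  So \<open>e^(-t) / (1 - t)\<close> is formed over the reals and then embedded
  coefficientwise, and \<open>e^(x t)\<close> is given by its coefficients \<open>x^k / k!\<close>.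
\<close>

definition derangement_egf :: "real poly fps" where
  "derangement_egf =
     Abs_fps (\<lambda>k. [:fps_nth (fps_exp (-1) / (1 - fps_X)) k:]) *
     Abs_fps (\<lambda>k. monom (1 / fact k) k)"

definition derangement_poly :: "nat \<Rightarrow> real poly" where
  "derangement_poly n = smult (fact n) (fps_nth derangement_egf n)"

text \<open>
  Evaluated at any real \<open>x\<close>, this is the generating function identity in its usual form.
\<close>

lemma derangement_poly_egf:
  "fps_exp (-1) / (1 - fps_X) * fps_exp x =
     Abs_fps (\<lambda>n. poly (derangement_poly n) x / fact n)"
  by (rule fps_ext)
     (simp add: derangement_poly_def derangement_egf_def fps_mult_nth poly_sum poly_monom)

end

theory Submission
  imports Defs
begin

text \<open>
  Multiplying the generating function \<open>e^(-t) e^(x t) / (1 - t)\<close> by \<open>1 - t\<close> cancels the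
  denominator and leaves \<open>e^((x - 1) t)\<close>, whose coefficients are \<open>(x - 1)^n / n!\<close>.
  On the other side, multiplication by \<open>1 - t\<close> takes the difference of consecutive
  coefficients, \<open>D_n(x) / n! - D_(n-1)(x) / (n-1)!\<close>.  Comparing coefficients and clearing
  \<open>n!\<close> gives the recurrence.
\<close>

lemma one_minus_X_times_derangement_series:
  fixes x :: real
  shows "(1 - fps_X) * Abs_fps (\<lambda>n. poly (derangement_poly n) x / fact n) = fps_exp (x - 1)"
proof -
  \<comment> \<open>The quotient is exact because \<open>1 - t\<close> has the nonzero constant coefficient \<open>1\<close>.\<close>
  have "(1 - fps_X) * (fps_exp (-1) / (1 - fps_X)) = (fps_exp (-1) :: real fps)"
    by (simp add: fps_divide_unit mult.left_commute[of "1 - fps_X"] inverse_mult_eq_1')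
  then have "(1 - fps_X) * (fps_exp (-1) / (1 - fps_X) * fps_exp x) = fps_exp (-1) * fps_exp x"
    by (simp only: mult.assoc[symmetric])
  also have "\<dots> = fps_exp (x - 1)"
    by (simp flip: fps_exp_add_mult)
  finally show ?thesis
    by (simp only: derangement_poly_egf)
qed

theorem lemma1:
  fixes n :: nat and x :: real
  assumes "n \<ge> 1"
  shows "poly (derangement_poly n) x - real n * poly (derangement_poly (n - 1)) x = (x - 1) ^ n"
proof -
  obtain m where n: "n = Suc m"
    using assms by (cases n) auto
  have "fps_nth ((1 - fps_X) * Abs_fps (\<lambda>n. poly (derangement_poly n) x / fact n)) n
      = (x - 1) ^ n / fact n"
    by (simp add: one_minus_X_times_derangement_series)
  then have "poly (derangement_poly n) x / fact n - poly (derangement_poly m) x / fact m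
      = (x - 1) ^ n / fact n"
    by (simp add: n left_diff_distrib)
  then show ?thesis
    by (simp add: n field_simps del: of_nat_Suc)
qed

end
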